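(* Let $Y$ and $Z$ be real Banach spaces, $\Omega$ a nonempty open subset of $Z$, and $k\in\mathbb N$. A subset $M$ of $\mathcal{BC}^k(\Omega,Y)$ is relatively compact if and only if it is bounded, extendedly $k$-equicontinuous and pointwise $k$-relatively compact.
   Context: Differentiability is in the Fréchet sense. $\mathcal C^k(\Omega,Y)$ is the space of $k$-times continuously differentiable functions $f:\Omega\to Y$; for $p=0,\dots,k$, $d^pf:\Omega\to W_p$ is the differential of order $p$, where $W_p=\mathcal L(Z^p,Y)$ is the Banach space of bounded $p$-linear operators with the operator norm $\|\cdot\|_{on}$ ($W_0=Y$, $d^0f=f$). $\mathcal{BC}^k(\Omega,Y)$ is the Banach space of all $f\in\mathcal C^k(\Omega,Y)$ which are bounded together with all differentials up to order $k$, with norm $\|f\|_{\mathcal{BC}^k}=\max\{\|f\|_\infty,\|df\|_\infty,\dots,\|d^kf\|_\infty\}$, $\|d^pf\|_\infty=\sup_{x\in\Omega}\|d^pf(x)\|_{on}$. A bounded set $M\subseteq\mathcal{BC}^k(\Omega,Y)$ is extendedly $k$-equicontinuous if $\omega_{\mathcal{BC}^k}(M)=0$, where $\omega_{\mathcal{BC}^k}(M)$ is the infimum of all $\varepsilon>0$ for which there are a finite partition $\{A_1,\dots,A_n\}$ of $\Omega$ and a finite set $\{\varphi_1,\dots,\varphi_m\}\subseteq\mathcal{BC}^k(\Omega,Y)$ such that for every $f\in M$ there is $j\in\{1,\dots,m\}$ with $\max_{0\le p\le k}\operatorname{diam}_{W_p}\big((d^p(f-\varphi_j))(A_i)\big)\le\varepsilon$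 for all $i=1,\dots,n$. It is pointwise $k$-relatively compact if $\mu_{\overline\alpha}(M)=\max_{0\le p\le k}\sup_{x\in\Omega}\alpha_p(M^p(x))=0$, where $M^p(x)=\{d^pf(x):f\in M\}\subseteq W_p$ and $\alpha_p$ is the Kuratowski measure of noncompactness in $W_p$ (infimum of all $\varepsilon>0$ such that the set can be covered by finitely many sets of diameter not greater than $\varepsilon$); equivalently, $M^p(x)$ is relatively compact in $W_p$ for every $x\in\Omega$ and $p=0,\dots,k$. *)

theory Defs
  imports "HOL-Analysis.Analysis"
begin

section \<open>Bounded multilinear operators\<close>

text \<open>
  The order p of a differential is a variable of the theory, so the Banach spaces
  \<open>W\<^sub>p = L(Z\<^sup>p, Y)\<close> cannot be separate types. They are realised as the subspaces
  \<open>mlin_space p\<close> of one normed space \<open>mlin\<close>. An element of that space is a function on argument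
  lists that is linear in every entry and whose operator norms, over all lengths of the list,
  are uniformly bounded; it belongs to \<open>mlin_space p\<close> if it vanishes on all lists of length
  other than p. On \<open>mlin_space p\<close> the norm is the usual norm of bounded p-linear operators
  (lemmas \<open>norm_mlin_space\<close> and \<open>norm_mlin_space_unit\<close> below), and on \<open>mlin_space 0\<close>, a copy
  of Y, it is the norm of Y.
\<close>

definition bounded_multilinear :: "('z::real_normed_vector list \<Rightarrow> 'y::real_normed_vector) \<Rightarrow> bool"
  where "bounded_multilinear T \<longleftrightarrow>
    (\<forall>us vs. linear (\<lambda>h. T (us @ h # vs))) \<and>
    (\<exists>K. \<forall>hs. norm (T hs) \<le> K * prod_list (map norm hs))"

typedef (overloaded) ('z, 'y) mlin =
  "{T :: 'z::real_normed_vector list \<Rightarrow> 'y::real_normed_vector. bounded_multilinear T}"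
  morphisms mlin_apply Mlin
proof
  have "linear (\<lambda>h::'z. 0::'y)" by (simp add: linear_iff)
  then show "(\<lambda>_. 0) \<in> {T :: 'z list \<Rightarrow> 'y. bounded_multilinear T}"
    by (auto simp: bounded_multilinear_def intro!: exI[of _ 0])
qed

setup_lifting type_definition_mlin

lemma prod_list_norm_nonneg: "0 \<le> prod_list (map norm (hs :: 'a::real_normed_vector list))"
  by (induction hs) auto

lemma bounded_multilinear_eq_0:
  assumes "bounded_multilinear T" "prod_list (map norm hs) = 0"
  shows "T hs = 0"
proof -
  obtain K where "\<And>hs. norm (T hs) \<le> K * prod_list (map norm hs)"
    using assms(1) unfolding bounded_multilinear_def by blast
  from this[of hs] show ?thesis using assms(2) by simp
qed

lemma bounded_multilinear_bdd:
  assumes "bounded_multilinear T"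
  shows "bdd_above (range (\<lambda>hs. norm (T hs) / prod_list (map norm hs)))"
proof -
  obtain K where K: "\<And>hs. norm (T hs) \<le> K * prod_list (map norm hs)"
    using assms(1) unfolding bounded_multilinear_def by blast
  have "norm (T hs) / prod_list (map norm hs) \<le> max 0 K" for hs
  proof (cases "prod_list (map norm hs) = 0")
    case False
    then have "0 < prod_list (map norm hs)"
      using prod_list_norm_nonneg[of hs] by linarith
    then have "norm (T hs) / prod_list (map norm hs) \<le> K"
      using K[of hs] by (simp add: divide_le_eq)
    then show ?thesis by simp
  qed simp
  then show ?thesis by (rule bdd_aboveI2)
qed

instantiation mlin :: (real_normed_vector, real_normed_vector) real_normed_vector
begin

lift_definition norm_mlin :: "('a, 'b) mlin \<Rightarrow> real"
  is "\<lambda>T. SUP hs. norm (T hs) / prod_list (map norm hs)" .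

lift_definition zero_mlin :: "('a, 'b) mlin" is "\<lambda>_. 0"
  by (auto simp: bounded_multilinear_def linear_iff intro!: exI[of _ 0])

lift_definition uminus_mlin :: "('a, 'b) mlin \<Rightarrow> ('a, 'b) mlin" is "\<lambda>S hs. - S hs"
  by (auto simp: bounded_multilinear_def linear_iff)

lift_definition plus_mlin :: "('a, 'b) mlin \<Rightarrow> ('a, 'b) mlin \<Rightarrow> ('a, 'b) mlin"
  is "\<lambda>S T hs. S hs + T hs"
proof -
  fix S T :: "'a list \<Rightarrow> 'b"
  assume S: "bounded_multilinear S" and T: "bounded_multilinear T"
  obtain K L where "\<And>hs. norm (S hs) \<le> K * prod_list (map norm hs)"
      "\<And>hs. norm (T hs) \<le> L * prod_list (map norm hs)"
    using S T unfolding bounded_multilinear_def by blast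
  then have "norm (S hs + T hs) \<le> (K + L) * prod_list (map norm hs)" for hs
    by (metis add_mono distrib_right norm_triangle_mono)
  then show "bounded_multilinear (\<lambda>hs. S hs + T hs)"
    using S T by (auto simp: bounded_multilinear_def intro: linear_compose_add)
qed

lift_definition scaleR_mlin :: "real \<Rightarrow> ('a, 'b) mlin \<Rightarrow> ('a, 'b) mlin"
  is "\<lambda>r T hs. r *\<^sub>R T hs"
proof -
  fix r and T :: "'a list \<Rightarrow> 'b"
  assume T: "bounded_multilinear T"
  obtain L where L: "\<And>hs. norm (T hs) \<le> L * prod_list (map norm hs)"
    using T unfolding bounded_multilinear_def by blast
  have "norm (r *\<^sub>R T hs) \<le> (\<bar>r\<bar> * L) * prod_list (map norm hs)" for hs
    using mult_left_mono[OF L[of hs], of "\<bar>r\<bar>"] by (simp add: mult.assoc)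
  then show "bounded_multilinear (\<lambda>hs. r *\<^sub>R T hs)"
    using T by (auto simp: bounded_multilinear_def intro: linear_compose_scale_right)
qed

definition minus_mlin :: "('a, 'b) mlin \<Rightarrow> ('a, 'b) mlin \<Rightarrow> ('a, 'b) mlin"
  where "minus_mlin S T = S + - T"

definition dist_mlin :: "('a, 'b) mlin \<Rightarrow> ('a, 'b) mlin \<Rightarrow> real"
  where "dist_mlin S T = norm (S - T)"

definition uniformity_mlin :: "(('a, 'b) mlin \<times> ('a, 'b) mlin) filter"
  where "uniformity_mlin = (INF e\<in>{0 <..}. principal {(x, y). dist x y < e})"

definition open_mlin :: "('a, 'b) mlin set \<Rightarrow> bool"
  where "open_mlin S = (\<forall>x\<in>S. \<forall>\<^sub>F (x', y) in uniformity. x' = x \<longrightarrow> y \<in> S)"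

definition sgn_mlin :: "('a, 'b) mlin \<Rightarrow> ('a, 'b) mlin"
  where "sgn_mlin T = inverse (norm T) *\<^sub>R T"

instance
proof
  fix S T U :: "('a, 'b) mlin" and r s :: real
  show "S - T = S + - T" by (rule minus_mlin_def)
  show "dist S T = norm (S - T)" by (rule dist_mlin_def)
  show "sgn T = inverse (norm T) *\<^sub>R T" by (rule sgn_mlin_def)
  show "(uniformity :: (('a, 'b) mlin \<times> ('a, 'b) mlin) filter)
      = (INF e\<in>{0 <..}. principal {(x, y). dist x y < e})"
    by (rule uniformity_mlin_def)
  show "open X = (\<forall>x\<in>X. \<forall>\<^sub>F (x', y) in uniformity. x' = x \<longrightarrow> y \<in> X)"
    for X :: "('a, 'b) mlin set"
    by (rule open_mlin_def)
  show "S + T + U = S + (T + U)" by transfer (simp add: add.assoc)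
  show "S + T = T + S" by transfer (simp add: add.commute)
  show "0 + S = S" by transfer simp
  show "- S + S = 0" by transfer simp
  show "r *\<^sub>R (S + T) = r *\<^sub>R S + r *\<^sub>R T" by transfer (simp add: scaleR_add_right)
  show "(r + s) *\<^sub>R S = r *\<^sub>R S + s *\<^sub>R S" by transfer (simp add: scaleR_add_left)
  show "r *\<^sub>R s *\<^sub>R S = (r * s) *\<^sub>R S" by transfer simp
  show "1 *\<^sub>R S = S" by transfer simp
  show "norm S = 0 \<longleftrightarrow> S = 0"
  proof transfer
    fix S :: "'a list \<Rightarrow> 'b"
    assume S: "bounded_multilinear S"
    let ?q = "\<lambda>hs. norm (S hs) / prod_list (map norm hs)"
    show "(SUP hs. ?q hs) = 0 \<longleftrightarrow> S = (\<lambda>_. 0)"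
    proof
      assume 0: "(SUP hs. ?q hs) = 0"
      have "S hs = 0" for hs
      proof (cases "prod_list (map norm hs) = 0")
        case True
        then show ?thesis using bounded_multilinear_eq_0[OF S] by blast
      next
        case False
        then have pos: "0 < prod_list (map norm hs)"
          using prod_list_norm_nonneg[of hs] by linarith
        have "?q hs \<le> 0"
          using cSUP_upper[OF _ bounded_multilinear_bdd[OF S], of hs] 0 by simp
        then show ?thesis using pos by (simp add: divide_le_eq)
      qed
      then show "S = (\<lambda>_. 0)" by blast
    qed simp
  qed
  show "norm (S + T) \<le> norm S + norm T"
  proof transfer
    fix S T :: "'a list \<Rightarrow> 'b"
    assume S: "bounded_multilinear S" and T: "bounded_multilinear T"
    let ?q = "\<lambda>S hs. norm (S hs) / prod_list (map norm hs)"
    show "(SUP hs. norm (S hs + T hs) / prod_list (map norm hs)) \<le> (SUP hs. ?q S hs) + (SUP hs. ?q T hs)"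
    proof (rule cSUP_least)
      fix hs
      have "norm (S hs + T hs) / prod_list (map norm hs) \<le> ?q S hs + ?q T hs"
        unfolding add_divide_distrib[symmetric]
        by (intro divide_right_mono norm_triangle_ineq prod_list_norm_nonneg)
      also have "\<dots> \<le> (SUP hs. ?q S hs) + (SUP hs. ?q T hs)"
        by (intro add_mono cSUP_upper bounded_multilinear_bdd S T UNIV_I)
      finally show "norm (S hs + T hs) / prod_list (map norm hs)
        \<le> (SUP hs. ?q S hs) + (SUP hs. ?q T hs)" .
    qed simp
  qed
  show "norm (r *\<^sub>R S) = \<bar>r\<bar> * norm S"
  proof transfer
    fix r and S :: "'a list \<Rightarrow> 'b"
    assume S: "bounded_multilinear S"
    let ?q = "\<lambda>hs. norm (S hs) / prod_list (map norm hs)"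
    have "(SUP hs. \<bar>r\<bar> * ?q hs) = \<bar>r\<bar> * (SUP hs. ?q hs)"
    proof -
      have "\<bar>r\<bar> * Sup (range ?q) = (SUP x\<in>range ?q. \<bar>r\<bar> * x)"
        by (rule continuous_at_Sup_mono)
          (auto intro!: monoI mult_left_mono bounded_multilinear_bdd[OF S] continuous_intros
            simp: mono_def)
      then show ?thesis by (simp add: image_image)
    qed
    then show "(SUP hs. norm (r *\<^sub>R S hs) / prod_list (map norm hs)) = \<bar>r\<bar> * (SUP hs. ?q hs)"
      by simp
  qed
qed

end

lemma mlin_apply_simps [simp]:
  fixes S T :: "('z::real_normed_vector, 'y::real_normed_vector) mlin"
  shows "mlin_apply (0 :: ('z, 'y) mlin) hs = 0"
    and "mlin_apply (S + T) hs = mlin_apply S hs + mlin_apply T hs"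
    and "mlin_apply (- S) hs = - mlin_apply S hs"
    and "mlin_apply (r *\<^sub>R S) hs = r *\<^sub>R mlin_apply S hs"
    and "mlin_apply (S - T) hs = mlin_apply S hs - mlin_apply T hs"
  unfolding diff_conv_add_uminus
  by (simp_all only: zero_mlin.rep_eq plus_mlin.rep_eq uminus_mlin.rep_eq scaleR_mlin.rep_eq)

lemma mlin_eqI: "(\<And>hs. mlin_apply S hs = mlin_apply T hs) \<Longrightarrow> S = T"
  by (rule iffD1[OF mlin_apply_inject]) (rule ext)

lemma norm_mlin_apply: "norm (mlin_apply T hs) \<le> norm T * prod_list (map norm hs)"
proof -
  have T: "bounded_multilinear (mlin_apply T)" using mlin_apply by blast
  show ?thesis
  proof (cases "prod_list (map norm hs) = 0")
    case True
    then show ?thesis using bounded_multilinear_eq_0[OF T] by simp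
  next
    case False
    then have "0 < prod_list (map norm hs)"
      using prod_list_norm_nonneg[of hs] by linarith
    then show ?thesis
      using cSUP_upper[OF _ bounded_multilinear_bdd[OF T], of hs]
      by (simp add: norm_mlin.rep_eq divide_le_eq)
  qed
qed

lemma norm_mlin_bound:
  assumes "0 \<le> b" "\<And>hs. norm (mlin_apply T hs) \<le> b * prod_list (map norm hs)"
  shows "norm T \<le> b"
proof -
  have "norm (mlin_apply T hs) / prod_list (map norm hs) \<le> b" for hs
    using assms prod_list_norm_nonneg[of hs]
    by (metis divide_eq_0_iff divide_le_eq order_le_less)
  then show ?thesis unfolding norm_mlin.rep_eq by (intro cSUP_least) auto
qed

definition mlin_space :: "nat \<Rightarrow> ('z::real_normed_vector, 'y::real_normed_vector) mlin set"
  where "mlin_space p = {T. \<forall>hs. length hs \<noteq> p \<longrightarrow> mlin_apply T hs = 0}"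

lemma norm_mlin_space:
  assumes "T \<in> mlin_space p"
  shows "norm T = Inf {b. 0 \<le> b \<and>
    (\<forall>hs. length hs = p \<longrightarrow> norm (mlin_apply T hs) \<le> b * prod_list (map norm hs))}"
    (is "_ = Inf ?B")
proof (rule cInf_eq_minimum[symmetric])
  show "norm T \<in> ?B" by (simp add: norm_mlin_apply)
next
  fix b assume b: "b \<in> ?B"
  show "norm T \<le> b"
  proof (rule norm_mlin_bound)
    fix hs
    show "norm (mlin_apply T hs) \<le> b * prod_list (map norm hs)"
      using b assms prod_list_norm_nonneg[of hs]
      by (cases "length hs = p") (auto simp: mlin_space_def)
  qed (use b in auto)
qed

lemma prod_list_norm_le_1:
  "(\<forall>h\<in>set hs. norm h \<le> 1) \<Longrightarrow> prod_list (map norm hs) \<le> 1"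
  by (induction hs) (auto intro!: mult_le_one prod_list_norm_nonneg)

lemma mlin_apply_scale1:
  "mlin_apply T (us @ (c *\<^sub>R h) # vs) = c *\<^sub>R mlin_apply T (us @ h # vs)"
  by transfer (auto simp: bounded_multilinear_def linear_iff)

lemma mlin_apply_normalize:
  "mlin_apply T (us @ hs) = prod_list (map norm hs) *\<^sub>R mlin_apply T (us @ map sgn hs)"
proof (induction hs arbitrary: us)
  case (Cons h hs)
  have "mlin_apply T (us @ h # hs) = mlin_apply T (us @ (norm h *\<^sub>R sgn h) # hs)"
    by (cases "h = 0") (simp_all add: sgn_div_norm)
  also have "\<dots> = norm h *\<^sub>R mlin_apply T ((us @ [sgn h]) @ hs)"
    by (simp only: mlin_apply_scale1) simp
  also have "\<dots> = norm h *\<^sub>R (prod_list (map norm hs) *\<^sub>R mlin_apply T ((us @ [sgn h]) @ map sgn hs))"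
    by (simp only: Cons.IH)
  finally show ?case by simp
qed simp

lemma norm_mlin_space_unit:
  assumes "T \<in> mlin_space p"
  shows "norm T = (SUP hs\<in>{hs. length hs = p \<and> (\<forall>h\<in>set hs. norm h \<le> 1)}. norm (mlin_apply T hs))"
    (is "_ = (SUP hs\<in>?U. _)")
proof (rule antisym)
  have le: "norm (mlin_apply T hs) \<le> norm T" if "hs \<in> ?U" for hs
    using norm_mlin_apply[of T hs] mult_left_mono[OF prod_list_norm_le_1[of hs] norm_ge_zero[of T]] that
    by simp
  have ne: "replicate p 0 \<in> ?U" by auto
  have bdd: "bdd_above ((\<lambda>hs. norm (mlin_apply T hs)) ` ?U)"
    by (rule bdd_aboveI2[of _ _ "norm T"]) (rule le)
  show "(SUP hs\<in>?U. norm (mlin_apply T hs)) \<le> norm T"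
    using ne by (intro cSUP_least le) blast+
  show "norm T \<le> (SUP hs\<in>?U. norm (mlin_apply T hs))" (is "_ \<le> ?s")
  proof (rule norm_mlin_bound)
    show s: "0 \<le> ?s"
      using cSUP_upper[OF ne bdd] norm_ge_zero order_trans by blast
    fix hs
    show "norm (mlin_apply T hs) \<le> ?s * prod_list (map norm hs)"
    proof (cases "length hs = p")
      case True
      then have "map sgn hs \<in> ?U" by (auto simp: norm_sgn)
      then have "norm (mlin_apply T (map sgn hs)) \<le> ?s" by (rule cSUP_upper[OF _ bdd])
      then show ?thesis
        using mlin_apply_normalize[of T "[]" hs] prod_list_norm_nonneg[of hs]
        by (simp add: mult.commute mult_left_mono)
    next
      case False
      then show ?thesis using assms s prod_list_norm_nonneg[of hs] by (simp add: mlin_space_def)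
    qed
  qed
qed

lift_definition mlin_const :: "'y \<Rightarrow> ('z::real_normed_vector, 'y::real_normed_vector) mlin"
  is "\<lambda>y hs. if hs = [] then y else 0"
  by (auto simp: bounded_multilinear_def linear_iff intro!: exI[of _ "norm _"]
      mult_nonneg_nonneg prod_list_norm_nonneg)

lemma norm_mlin_const: "norm (mlin_const y) = norm y"
proof (rule antisym)
  show "norm (mlin_const y :: ('a, 'b) mlin) \<le> norm y"
    by (rule norm_mlin_bound)
      (auto simp: mlin_const.rep_eq intro!: mult_nonneg_nonneg prod_list_norm_nonneg)
  show "norm y \<le> norm (mlin_const y :: ('a, 'b) mlin)"
    using norm_mlin_apply[of "mlin_const y :: ('a, 'b) mlin" "[]"] by (simp add: mlin_const.rep_eq)
qed

text \<open>The identification of \<open>L(Z, L(Z\<^sup>p, Y))\<close> with \<open>L(Z\<^sup>p\<^sup>+\<^sup>1, Y)\<close>.\<close>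

lift_definition mlin_uncurry ::
  "('z \<Rightarrow>\<^sub>L ('z, 'y) mlin) \<Rightarrow> ('z::real_normed_vector, 'y::real_normed_vector) mlin"
  is "\<lambda>L hs. case hs of [] \<Rightarrow> 0 | h # hs' \<Rightarrow> mlin_apply (blinfun_apply L h) hs'"
proof -
  fix L :: "'z \<Rightarrow>\<^sub>L ('z, 'y) mlin"
  let ?T = "\<lambda>hs. case hs of [] \<Rightarrow> 0 | h # hs' \<Rightarrow> mlin_apply (blinfun_apply L h) hs'"
  have "linear (\<lambda>h. ?T (us @ h # vs))" for us vs
  proof (cases us)
    case Nil
    then show ?thesis by (simp add: linear_iff blinfun.add_right blinfun.scaleR_right)
  next
    case (Cons u us')
    have "bounded_multilinear (mlin_apply (blinfun_apply L u))" using mlin_apply by blast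
    then show ?thesis using Cons by (simp add: bounded_multilinear_def)
  qed
  moreover have "norm (?T hs) \<le> norm L * prod_list (map norm hs)" for hs
  proof (cases hs)
    case (Cons h hs')
    have "norm (mlin_apply (blinfun_apply L h) hs') \<le> norm (blinfun_apply L h) * prod_list (map norm hs')"
      by (rule norm_mlin_apply)
    also have "\<dots> \<le> (norm L * norm h) * prod_list (map norm hs')"
      by (intro mult_right_mono norm_blinfun prod_list_norm_nonneg)
    finally show ?thesis using Cons by (simp add: mult.assoc)
  qed simp
  ultimately show "bounded_multilinear ?T" unfolding bounded_multilinear_def by blast
qed


section \<open>Differentials and the space of k-times boundedly differentiable functions\<close>

text \<open>
  \<open>ndiff p f x\<close> is the differential of order p of f at x,
  \<open>d\<^sup>p\<^sup>+\<^sup>1f(x)(h, h\<^sub>1, \<dots>, h\<^sub>p) = (D(d\<^sup>pf)(x) h)(h\<^sub>1, \<dots>, h\<^sub>p)\<close>.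
  Only its values at the points of an open set \<open>\<Omega>\<close> on which f is sufficiently often
  differentiable are meaningful; there they depend on f restricted to \<open>\<Omega>\<close> alone.
\<close>

primrec ndiff :: "nat \<Rightarrow> ('z::real_normed_vector \<Rightarrow> 'y::real_normed_vector) \<Rightarrow> 'z \<Rightarrow> ('z, 'y) mlin"
  where
    "ndiff 0 f = (\<lambda>x. mlin_const (f x))"
  | "ndiff (Suc p) f = (\<lambda>x. mlin_uncurry (Blinfun (frechet_derivative (ndiff p f) (at x))))"

definition Ck :: "nat \<Rightarrow> 'z set \<Rightarrow> ('z::real_normed_vector \<Rightarrow> 'y::real_normed_vector) \<Rightarrow> bool"
  where "Ck k \<Omega> f \<longleftrightarrow>
    (\<forall>p<k. \<forall>x\<in>\<Omega>. ndiff p f differentiable (at x)) \<and>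
    (\<forall>p\<le>k. continuous_on \<Omega> (ndiff p f))"

text \<open>
  A function on \<open>\<Omega>\<close> is represented by its unique extension vanishing outside \<open>\<Omega>\<close>; thus
  distinct elements of \<open>BC k \<Omega>\<close> are distinct functions on \<open>\<Omega>\<close>, and sums and multiples are
  pointwise.
\<close>

definition BC :: "nat \<Rightarrow> 'z set \<Rightarrow> ('z::real_normed_vector \<Rightarrow> 'y::real_normed_vector) set"
  where "BC k \<Omega> = {f. Ck k \<Omega> f \<and> (\<forall>x. x \<notin> \<Omega> \<longrightarrow> f x = 0) \<and> (\<forall>p\<le>k. bounded (ndiff p f ` \<Omega>))}"

definition BC_norm :: "nat \<Rightarrow> 'z set \<Rightarrow> ('z::real_normed_vector \<Rightarrow> 'y::real_normed_vector) \<Rightarrow> real"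
  where "BC_norm k \<Omega> f = (MAX p\<in>{..k}. SUP x\<in>\<Omega>. norm (ndiff p f x))"

text \<open>
  The guard makes the distance nonnegative and symmetric on all pairs of functions, which the
  locale \<open>Metric_space\<close> demands.
\<close>

definition BC_dist ::
  "nat \<Rightarrow> 'z set \<Rightarrow> ('z::real_normed_vector \<Rightarrow> 'y::real_normed_vector) \<Rightarrow> ('z \<Rightarrow> 'y) \<Rightarrow> real"
  where "BC_dist k \<Omega> f g =
    (if f \<in> BC k \<Omega> \<and> g \<in> BC k \<Omega> then BC_norm k \<Omega> (\<lambda>x. f x - g x) else 0)"

lemma ndiff_mlin_space:
  assumes "open \<Omega>" "\<And>q x. q < p \<Longrightarrow> x \<in> \<Omega> \<Longrightarrow> ndiff q f differentiable (at x)" "x \<in> \<Omega>"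
  shows "ndiff p f x \<in> mlin_space p"
  using assms(2,3)
proof (induction p arbitrary: x)
  case 0
  then show ?case by (simp add: mlin_space_def mlin_const.rep_eq)
next
  case (Suc p)
  let ?D = "frechet_derivative (ndiff p f) (at x)"
  have D: "(ndiff p f has_derivative ?D) (at x)"
    using Suc.prems frechet_derivative_works by blast
  have "mlin_apply (?D h) hs = 0" if len: "length hs \<noteq> p" for h hs
  proof -
    have bl: "bounded_linear (\<lambda>T :: ('a, 'b) mlin. mlin_apply T hs)"
      by (rule bounded_linear_intro[where K = "prod_list (map norm hs)"]) (auto simp: norm_mlin_apply)
    have "((\<lambda>y. mlin_apply (ndiff p f y) hs) has_derivative (\<lambda>h. mlin_apply (?D h) hs)) (at x)"
      by (rule bounded_linear.has_derivative[OF bl D])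
    moreover have "((\<lambda>y. mlin_apply (ndiff p f y) hs) has_derivative (\<lambda>h. 0)) (at x)"
    proof (rule has_derivative_transform_within_open[OF has_derivative_const assms(1) Suc.prems(2)])
      show "0 = mlin_apply (ndiff p f y) hs" if "y \<in> \<Omega>" for y
        using Suc.IH[OF _ that] Suc.prems(1) len by (simp add: mlin_space_def)
    qed
    ultimately show ?thesis by (metis has_derivative_unique)
  qed
  then show ?case
    using has_derivative_bounded_linear[OF D]
    by (auto simp: mlin_space_def mlin_uncurry.rep_eq bounded_linear_Blinfun_apply split: list.split)
qed

lemma ndiff_Suc_apply:
  assumes "(ndiff p f has_derivative D) (at x)"
  shows "mlin_apply (ndiff (Suc p) f x) (h # hs) = mlin_apply (D h) hs"
  using frechet_derivative_at[OF assms] has_derivative_bounded_linear[OF assms]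
  by (simp add: mlin_uncurry.rep_eq bounded_linear_Blinfun_apply)

lemma ndiff_diff:
  assumes "open \<Omega>" "Ck k \<Omega> f" "Ck k \<Omega> g" "p \<le> k" "x \<in> \<Omega>"
  shows "ndiff p (\<lambda>x. f x - g x) x = ndiff p f x - ndiff p g x"
    and "p < k \<Longrightarrow> ndiff p (\<lambda>x. f x - g x) differentiable (at x)"
proof -
  have has_D: "(ndiff p F has_derivative frechet_derivative (ndiff p F) (at x)) (at x)"
    if "Ck k \<Omega> F" "p < k" "x \<in> \<Omega>" for F :: "'a \<Rightarrow> 'b" and p x
  proof -
    have "ndiff p F differentiable (at x)" using that unfolding Ck_def by blast
    then show ?thesis by (simp only: frechet_derivative_works)
  qed
  have diffble: "((\<lambda>y. ndiff p f y - ndiff p g y) has_derivative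
      (\<lambda>h. frechet_derivative (ndiff p f) (at x) h - frechet_derivative (ndiff p g) (at x) h)) (at x)"
    if "p < k" "x \<in> \<Omega>" for p x
  proof (rule has_derivative_diff)
    show "(ndiff p f has_derivative frechet_derivative (ndiff p f) (at x)) (at x)"
      using has_D[OF assms(2) that] .
    show "(ndiff p g has_derivative frechet_derivative (ndiff p g) (at x)) (at x)"
      using has_D[OF assms(3) that] .
  qed
  have eq: "ndiff p (\<lambda>x. f x - g x) x = ndiff p f x - ndiff p g x" if "p \<le> k" "x \<in> \<Omega>" for p x
    using that
  proof (induction p arbitrary: x)
    case 0
    have "mlin_apply (mlin_const (f x - g x) :: ('a, 'b) mlin) hs
        = mlin_apply (mlin_const (f x) - mlin_const (g x)) hs" for hs
      by (simp add: mlin_const.rep_eq)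
    then show ?case unfolding ndiff.simps(1) by (rule mlin_eqI)
  next
    case (Suc p)
    have D: "(ndiff p (\<lambda>x. f x - g x) has_derivative
      (\<lambda>h. frechet_derivative (ndiff p f) (at x) h - frechet_derivative (ndiff p g) (at x) h)) (at x)"
    proof (rule has_derivative_transform_within_open[OF diffble assms(1)])
      show "p < k" "x \<in> \<Omega>" "x \<in> \<Omega>" using Suc.prems by auto
      show "ndiff p f y - ndiff p g y = ndiff p (\<lambda>x. f x - g x) y" if "y \<in> \<Omega>" for y
        using Suc.IH[OF _ that] Suc.prems(1) by simp
    qed
    have F: "(ndiff p f has_derivative frechet_derivative (ndiff p f) (at x)) (at x)"
      and G: "(ndiff p g has_derivative frechet_derivative (ndiff p g) (at x)) (at x)"
      using has_D[OF assms(2)] has_D[OF assms(3)] Suc.prems by simp_all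
    have "mlin_apply (ndiff (Suc p) (\<lambda>x. f x - g x) x) hs
        = mlin_apply (ndiff (Suc p) f x - ndiff (Suc p) g x) hs" for hs
    proof (cases hs)
      case Nil
      then show ?thesis by (simp add: mlin_uncurry.rep_eq)
    next
      case (Cons h hs')
      then show ?thesis
        by (simp only: Cons mlin_apply_simps ndiff_Suc_apply[OF D] ndiff_Suc_apply[OF F]
            ndiff_Suc_apply[OF G])
    qed
    then show ?case by (rule mlin_eqI)
  qed
  show "ndiff p (\<lambda>x. f x - g x) x = ndiff p f x - ndiff p g x"
    using eq assms by blast
  show "ndiff p (\<lambda>x. f x - g x) differentiable (at x)" if "p < k"
  proof -
    have "(ndiff p (\<lambda>x. f x - g x) has_derivative
      (\<lambda>h. frechet_derivative (ndiff p f) (at x) h - frechet_derivative (ndiff p g) (at x) h)) (at x)"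
    proof (rule has_derivative_transform_within_open[OF diffble assms(1)])
      show "p < k" "x \<in> \<Omega>" "x \<in> \<Omega>" using that assms(5) by auto
      show "ndiff p f y - ndiff p g y = ndiff p (\<lambda>x. f x - g x) y" if "y \<in> \<Omega>" for y
        using eq[OF assms(4) that] by simp
    qed
    then show ?thesis by (rule differentiableI)
  qed
qed

lemma Ck_diff:
  assumes "open \<Omega>" "Ck k \<Omega> f" "Ck k \<Omega> g"
  shows "Ck k \<Omega> (\<lambda>x. f x - g x)"
  unfolding Ck_def
proof (intro conjI allI impI ballI)
  show "ndiff p (\<lambda>x. f x - g x) differentiable (at x)" if "p < k" "x \<in> \<Omega>" for p x
    using ndiff_diff(2)[OF assms _ that(2) that(1)] that by simp
  show "continuous_on \<Omega> (ndiff p (\<lambda>x. f x - g x))" if "p \<le> k" for p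
  proof -
    have "continuous_on \<Omega> (\<lambda>x. ndiff p f x - ndiff p g x)"
      using assms that by (intro continuous_on_diff) (auto simp: Ck_def)
    then show ?thesis
      using ndiff_diff(1)[OF assms that] by (simp cong: continuous_on_cong)
  qed
qed

lemma BC_diff:
  assumes "open \<Omega>" "f \<in> BC k \<Omega>" "g \<in> BC k \<Omega>"
  shows "(\<lambda>x. f x - g x) \<in> BC k \<Omega>"
proof -
  have C: "Ck k \<Omega> f" "Ck k \<Omega> g" using assms by (auto simp: BC_def)
  have "bounded (ndiff p (\<lambda>x. f x - g x) ` \<Omega>)" if "p \<le> k" for p
  proof -
    have "bounded ((\<lambda>x. ndiff p f x - ndiff p g x) ` \<Omega>)"
      using assms that by (intro bounded_minus_comp) (auto simp: BC_def)
    then show ?thesis using ndiff_diff(1)[OF assms(1) C that] by (simp cong: image_cong)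
  qed
  then show ?thesis using Ck_diff[OF assms(1) C] assms by (auto simp: BC_def)
qed

lemma BC_dist_le_iff:
  assumes "open \<Omega>" "\<Omega> \<noteq> {}" "f \<in> BC k \<Omega>" "g \<in> BC k \<Omega>"
  shows "BC_dist k \<Omega> f g \<le> e \<longleftrightarrow> (\<forall>p\<le>k. \<forall>x\<in>\<Omega>. dist (ndiff p f x) (ndiff p g x) \<le> e)"
proof -
  have C: "Ck k \<Omega> f" "Ck k \<Omega> g" using assms by (auto simp: BC_def)
  let ?h = "\<lambda>x. f x - g x"
  have "(SUP x\<in>\<Omega>. norm (ndiff p ?h x)) \<le> e \<longleftrightarrow> (\<forall>x\<in>\<Omega>. dist (ndiff p f x) (ndiff p g x) \<le> e)"
    if "p \<le> k" for p
  proof -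
    have "bounded (ndiff p ?h ` \<Omega>)" using BC_diff[OF assms(1,3,4)] that by (auto simp: BC_def)
    then have "bdd_above ((\<lambda>x. norm (ndiff p ?h x)) ` \<Omega>)"
      by (auto simp: bounded_iff bdd_above_def)
    then show ?thesis
      using assms(2) ndiff_diff(1)[OF assms(1) C that] by (simp add: cSUP_le_iff dist_norm)
  qed
  then show ?thesis using assms(3,4) by (auto simp: BC_dist_def BC_norm_def)
qed

lemma Metric_space_BC:
  assumes "open \<Omega>" "\<Omega> \<noteq> {}"
  shows "Metric_space (BC k \<Omega>) (BC_dist k \<Omega>
    :: ('z::real_normed_vector \<Rightarrow> 'y::real_normed_vector) \<Rightarrow> _)"
proof
  note le_iff = BC_dist_le_iff[OF assms]
  obtain a where a: "a \<in> \<Omega>" using assms by blast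
  have bd: "dist (ndiff p f x) (ndiff p g x) \<le> BC_dist k \<Omega> f g"
    if "f \<in> BC k \<Omega>" "g \<in> BC k \<Omega>" "p \<le> k" "x \<in> \<Omega>" for f g :: "'z \<Rightarrow> 'y" and p x
    using le_iff[of f k g "BC_dist k \<Omega> f g"] that by blast
  show "0 \<le> BC_dist k \<Omega> f g" for f g :: "'z \<Rightarrow> 'y"
  proof (cases "f \<in> BC k \<Omega> \<and> g \<in> BC k \<Omega>")
    case True
    then show ?thesis using bd[of f g 0 a] a zero_le_dist order_trans by blast
  qed (auto simp: BC_dist_def)
  show "BC_dist k \<Omega> f g = BC_dist k \<Omega> g f" for f g :: "'z \<Rightarrow> 'y"
  proof (cases "f \<in> BC k \<Omega> \<and> g \<in> BC k \<Omega>")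
    case True
    then have f: "f \<in> BC k \<Omega>" and g: "g \<in> BC k \<Omega>" by auto
    show ?thesis
      using bd[OF f g] bd[OF g f] by (intro antisym) (simp_all add: le_iff f g dist_commute)
  qed (auto simp: BC_dist_def)
  fix f g h :: "'z \<Rightarrow> 'y"
  assume f: "f \<in> BC k \<Omega>" and g: "g \<in> BC k \<Omega>"
  show "(BC_dist k \<Omega> f g = 0) = (f = g)"
  proof
    assume 0: "BC_dist k \<Omega> f g = 0"
    show "f = g"
    proof
      fix x
      show "f x = g x"
      proof (cases "x \<in> \<Omega>")
        case True
        then have "(mlin_const (f x) :: ('z, 'y) mlin) = mlin_const (g x)"
          using bd[OF f g, of 0 x] 0 by simp
        then have "mlin_apply (mlin_const (f x) :: ('z, 'y) mlin) []
            = mlin_apply (mlin_const (g x) :: ('z, 'y) mlin) []"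
          by simp
        then show ?thesis by (simp add: mlin_const.rep_eq)
      qed (use f g in \<open>simp add: BC_def\<close>)
    qed
  next
    assume "f = g"
    then have "BC_dist k \<Omega> f g \<le> 0" using f g by (subst le_iff) auto
    moreover have "0 \<le> BC_dist k \<Omega> f g"
      using bd[OF f g, of 0 a] a zero_le_dist order_trans by blast
    ultimately show "BC_dist k \<Omega> f g = 0" by simp
  qed
  assume h: "h \<in> BC k \<Omega>"
  show "BC_dist k \<Omega> f h \<le> BC_dist k \<Omega> f g + BC_dist k \<Omega> g h"
    unfolding le_iff[OF f h]
    using bd[OF f g] bd[OF g h] by (meson add_mono dist_triangle order_trans)
qed


section \<open>Compactness and equicontinuity notions\<close>

definition BC_relatively_compact ::
  "nat \<Rightarrow> 'z set \<Rightarrow> ('z::real_normed_vector \<Rightarrow> 'y::real_normed_vector) set \<Rightarrow> bool"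
  where "BC_relatively_compact k \<Omega> M \<longleftrightarrow>
    compactin (Metric_space.mtopology (BC k \<Omega>) (BC_dist k \<Omega>))
      (Metric_space.mtopology (BC k \<Omega>) (BC_dist k \<Omega>) closure_of M)"

definition BC_bounded ::
  "nat \<Rightarrow> 'z set \<Rightarrow> ('z::real_normed_vector \<Rightarrow> 'y::real_normed_vector) set \<Rightarrow> bool"
  where "BC_bounded k \<Omega> M \<longleftrightarrow> Metric_space.mbounded (BC k \<Omega>) (BC_dist k \<Omega>) M"

text \<open>
  Infima are taken in \<open>ennreal\<close>, where the infimum of the empty set is infinite. The conjunct
  \<open>bounded B\<close> is needed because \<open>diameter\<close> is real-valued and unspecified on unbounded sets.
  Whether the covering sets are taken in \<open>mlin\<close> or in \<open>mlin_space p\<close> makes no difference for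
  subsets A of \<open>mlin_space p\<close>, as they may be intersected with A.
\<close>

definition kuratowski :: "'a::metric_space set \<Rightarrow> ennreal"
  where "kuratowski A = (INF \<epsilon>\<in>{\<epsilon>::real. 0 < \<epsilon> \<and>
    (\<exists>\<B>. finite \<B> \<and> A \<subseteq> \<Union>\<B> \<and> (\<forall>B\<in>\<B>. bounded B \<and> diameter B \<le> \<epsilon>))}. ennreal \<epsilon>)"

definition mu_alpha ::
  "nat \<Rightarrow> 'z set \<Rightarrow> ('z::real_normed_vector \<Rightarrow> 'y::real_normed_vector) set \<Rightarrow> ennreal"
  where "mu_alpha k \<Omega> M = (MAX p\<in>{..k}. SUP x\<in>\<Omega>. kuratowski ((\<lambda>f. ndiff p f x) ` M))"

definition pointwise_relatively_compact ::
  "nat \<Rightarrow> 'z set \<Rightarrow> ('z::real_normed_vector \<Rightarrow> 'y::real_normed_vector) set \<Rightarrow> bool"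
  where "pointwise_relatively_compact k \<Omega> M \<longleftrightarrow> mu_alpha k \<Omega> M = 0"

text \<open>
  For M included in \<open>BC k \<Omega>\<close> all the sets whose diameters occur here are bounded.
\<close>

definition omega_BC ::
  "nat \<Rightarrow> 'z set \<Rightarrow> ('z::real_normed_vector \<Rightarrow> 'y::real_normed_vector) set \<Rightarrow> ennreal"
  where "omega_BC k \<Omega> M = (INF \<epsilon>\<in>{\<epsilon>::real. 0 < \<epsilon> \<and>
    (\<exists>P \<Phi>. finite P \<and> partition_on \<Omega> P \<and> finite \<Phi> \<and> \<Phi> \<subseteq> BC k \<Omega> \<and>
      (\<forall>f\<in>M. \<exists>\<phi>\<in>\<Phi>. \<forall>A\<in>P. (MAX p\<in>{..k}. diameter (ndiff p (\<lambda>x. f x - \<phi> x) ` A)) \<le> \<epsilon>))}.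
    ennreal \<epsilon>)"

definition extendedly_equicontinuous ::
  "nat \<Rightarrow> 'z set \<Rightarrow> ('z::real_normed_vector \<Rightarrow> 'y::real_normed_vector) set \<Rightarrow> bool"
  where "extendedly_equicontinuous k \<Omega> M \<longleftrightarrow> omega_BC k \<Omega> M = 0"

end

theory Submission
  imports Defs
begin

text \<open>
  Since \<open>BC k \<Omega>\<close> is complete, relative compactness is total boundedness. A finite net of M with
  radius \<open>\<epsilon>\<close> serves as \<open>\<Phi>\<close> together with the trivial partition of \<open>\<Omega>\<close>, and evaluating it at x gives
  a finite net of the values. Conversely, pick a point in every cell A of the partition. Members
  of M that share their \<open>\<phi>\<close> and have close differentials at the chosen points are close on all of
  \<open>\<Omega>\<close>, and the finitely many covers of the values at these points sort M into finitely many classes.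
\<close>

section \<open>Completeness of the space of multilinear operators\<close>

text \<open>Evaluation at a fixed argument list is bounded and linear, so a Cauchy sequence
  converges on every list. Linearity in each slot and the common bound \<open>K\<close> pass to the
  pointwise limit, and the Cauchy estimate, uniform over all lists, turns pointwise convergence into
  convergence in norm.\<close>

instance mlin :: (real_normed_vector, banach) banach
proof
  fix X :: "nat \<Rightarrow> ('a, 'b) mlin"
  assume X: "Cauchy X"
  have diff: "norm (mlin_apply (X m) hs - mlin_apply (X n) hs) \<le> norm (X m - X n) * prod_list (map norm hs)"
    for m n hs
    using norm_mlin_apply[of "X m - X n" hs] by simp
  have "convergent (\<lambda>n. mlin_apply (X n) hs)" for hs
  proof -
    have bl: "bounded_linear (\<lambda>T :: ('a, 'b) mlin. mlin_apply T hs)"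
      by (rule bounded_linear_intro[where K = "prod_list (map norm hs)"]) (auto simp: norm_mlin_apply)
    show ?thesis
      using bounded_linear.Cauchy[OF bl X] by (simp add: Cauchy_convergent_iff)
  qed
  then obtain T where T: "\<And>hs. (\<lambda>n. mlin_apply (X n) hs) \<longlonglongrightarrow> T hs"
    unfolding convergent_def by metis
  obtain K where K: "\<And>n. norm (X n) \<le> K"
    using cauchy_imp_bounded[OF X] by (auto simp: bounded_iff)
  have "bounded_multilinear T"
    unfolding bounded_multilinear_def
  proof (intro conjI allI exI)
    fix us vs :: "'a list"
    have L: "linear (\<lambda>h. mlin_apply (X n) (us @ h # vs))" for n
      using mlin_apply[of "X n"] by (simp add: bounded_multilinear_def)
    show "linear (\<lambda>h. T (us @ h # vs))"
    proof (rule linearI)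
      fix a b :: 'a and r :: real
      have "(\<lambda>n. mlin_apply (X n) (us @ (a + b) # vs)) \<longlonglongrightarrow> T (us @ a # vs) + T (us @ b # vs)"
        using tendsto_add[OF T T] by (simp add: linear_add[OF L])
      then show "T (us @ (a + b) # vs) = T (us @ a # vs) + T (us @ b # vs)"
        using T LIMSEQ_unique by blast
      have "(\<lambda>n. mlin_apply (X n) (us @ (r *\<^sub>R a) # vs)) \<longlonglongrightarrow> r *\<^sub>R T (us @ a # vs)"
        using tendsto_scaleR[OF tendsto_const T] by (simp add: linear_scale[OF L])
      then show "T (us @ (r *\<^sub>R a) # vs) = r *\<^sub>R T (us @ a # vs)"
        using T LIMSEQ_unique by blast
    qed
    show "norm (T hs) \<le> K * prod_list (map norm hs)" for hs
    proof (rule LIMSEQ_le_const2[OF tendsto_norm[OF T]], intro exI allI impI)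
      show "norm (mlin_apply (X n) hs) \<le> K * prod_list (map norm hs)" for n
        by (rule order_trans[OF norm_mlin_apply mult_right_mono[OF K prod_list_norm_nonneg]])
    qed
  qed
  then have apply_T: "mlin_apply (Mlin T) = T"
    by (simp add: Mlin_inverse)
  have "X \<longlonglongrightarrow> Mlin T"
  proof (rule LIMSEQ_I)
    fix e :: real
    assume "0 < e"
    then obtain N where N: "\<And>m n. N \<le> m \<Longrightarrow> N \<le> n \<Longrightarrow> norm (X m - X n) < e / 2"
      using CauchyD[OF X, of "e / 2"] by auto
    \<comment> \<open>With \<open>n\<close> fixed, \<open>m\<close> tends to infinity in the Cauchy
      estimate. The limit keeps only a non-strict bound, hence \<open>e / 2\<close>.\<close>
    have "norm (X n - Mlin T) \<le> e / 2" if n: "N \<le> n" for n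
    proof (rule norm_mlin_bound)
      fix hs
      have "norm (mlin_apply (X n) hs - T hs) \<le> e / 2 * prod_list (map norm hs)"
      proof (rule LIMSEQ_le_const2[OF tendsto_norm[OF tendsto_diff[OF tendsto_const T]]],
          intro exI allI impI)
        show "norm (mlin_apply (X n) hs - mlin_apply (X m) hs) \<le> e / 2 * prod_list (map norm hs)"
          if "N \<le> m" for m
          using order_trans[OF diff mult_right_mono[OF less_imp_le[OF N[OF n that]] prod_list_norm_nonneg]] .
      qed
      then show "norm (mlin_apply (X n - Mlin T) hs) \<le> e / 2 * prod_list (map norm hs)"
        by (simp add: apply_T)
    qed (use \<open>0 < e\<close> in simp)
    then show "\<exists>N. \<forall>n\<ge>N. norm (X n - Mlin T) < e"
      using \<open>0 < e\<close> by (intro exI[of _ N]) force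
  qed
  then show "convergent X" by (rule convergentI)
qed

section \<open>Uncurrying and constants as isometries\<close>

lemma mlin_uncurry_diff: "mlin_uncurry (K - L) = mlin_uncurry K - mlin_uncurry L"
  by (rule mlin_eqI) (simp add: mlin_uncurry.rep_eq blinfun.diff_left split: list.split)

text \<open>One inequality peels the first argument off a list, the other applies the uncurried
  operator to \<open>h # hs\<close>. Being isometric, \<open>mlin_uncurry\<close> translates Cauchy
  estimates for \<open>ndiff (Suc p)\<close> into estimates for the derivatives of
  \<open>ndiff p\<close> as bounded linear operators, and limits back again.\<close>

lemma norm_mlin_uncurry: "norm (mlin_uncurry L) = norm L"
proof (rule antisym)
  show "norm (mlin_uncurry L) \<le> norm L"
  proof (rule norm_mlin_bound)
    fix hs
    show "norm (mlin_apply (mlin_uncurry L) hs) \<le> norm L * prod_list (map norm hs)"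
    proof (cases hs)
      case (Cons h hs')
      have "norm (mlin_apply (blinfun_apply L h) hs') \<le> norm (blinfun_apply L h) * prod_list (map norm hs')"
        by (rule norm_mlin_apply)
      also have "\<dots> \<le> (norm L * norm h) * prod_list (map norm hs')"
        by (intro mult_right_mono norm_blinfun prod_list_norm_nonneg)
      finally show ?thesis using Cons by (simp add: mlin_uncurry.rep_eq mult.assoc)
    qed (simp add: mlin_uncurry.rep_eq)
  qed simp
  show "norm L \<le> norm (mlin_uncurry L)"
  proof (rule norm_blinfun_bound)
    show "norm (blinfun_apply L h) \<le> norm (mlin_uncurry L) * norm h" for h
    proof (rule norm_mlin_bound)
      show "norm (mlin_apply (blinfun_apply L h) hs) \<le> norm (mlin_uncurry L) * norm h * prod_list (map norm hs)"
        for hs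
        using norm_mlin_apply[of "mlin_uncurry L" "h # hs"] by (simp add: mlin_uncurry.rep_eq mult.assoc)
    qed simp
  qed simp
qed

lemma dist_mlin_uncurry: "dist (mlin_uncurry K) (mlin_uncurry L) = dist K L"
  by (simp add: dist_norm norm_mlin_uncurry flip: mlin_uncurry_diff)

lemma dist_mlin_const: "dist (mlin_const y :: ('z::real_normed_vector, 'y::real_normed_vector) mlin) (mlin_const z) = dist y z"
proof -
  have "(mlin_const y - mlin_const z :: ('z, 'y) mlin) = mlin_const (y - z)"
    by (rule mlin_eqI) (simp add: mlin_const.rep_eq)
  then show ?thesis by (simp add: dist_norm norm_mlin_const)
qed

section \<open>Completeness of the space of boundedly differentiable functions\<close>

text \<open>\<open>ndiff\<close> goes through the chosen \<open>frechet_derivative\<close>;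
  uniqueness of the derivative replaces it by whichever derivative is at hand.\<close>

lemma ndiff_Suc_has_derivative:
  assumes "(ndiff p f has_derivative blinfun_apply L) (at x)"
  shows "ndiff (Suc p) f x = mlin_uncurry L"
  unfolding ndiff.simps frechet_derivative_at[OF assms, symmetric] by (simp add: blinfun_apply_inverse)

text \<open>The interchange theorem \<open>has_derivative_sequence\<close> asks for a convex domain,
  so it is applied on a ball around \<open>x\<close> inside the open set \<open>S\<close>.\<close>

lemma has_derivative_uniform_limit:
  fixes f :: "nat \<Rightarrow> 'a::real_normed_vector \<Rightarrow> 'b::banach" and S :: "'a set"
  assumes "open S"
    and der: "\<And>n x. x \<in> S \<Longrightarrow> (f n has_derivative blinfun_apply (D n x)) (at x)"
    and f: "\<And>x. x \<in> S \<Longrightarrow> (\<lambda>n. f n x) \<longlonglongrightarrow> g x"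
    and D: "uniform_limit S D D' sequentially"
    and "x \<in> S"
  shows "(g has_derivative blinfun_apply (D' x)) (at x)"
proof -
  obtain r where r: "0 < r" "ball x r \<subseteq> S"
    using assms(1) \<open>x \<in> S\<close> by (auto simp: open_contains_ball)
  have "\<exists>G. \<forall>y\<in>ball x r. (\<lambda>n. f n y) \<longlonglongrightarrow> G y \<and>
      (G has_derivative blinfun_apply (D' y)) (at y within ball x r)"
  proof (rule has_derivative_sequence)
    show "(f n has_derivative blinfun_apply (D n y)) (at y within ball x r)" if "y \<in> ball x r" for n y
      using der[of y n] that r(2) by (blast intro: has_derivative_at_withinI)
    show "\<forall>\<^sub>F n in sequentially. \<forall>y\<in>ball x r. \<forall>h.
        norm (blinfun_apply (D n y) h - blinfun_apply (D' y) h) \<le> e * norm h" if "0 < e" for e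
    proof (rule eventually_mono[OF uniform_limitD[OF D that]], intro ballI allI)
      fix n y and h :: 'a
      assume *: "\<forall>y\<in>S. dist (D n y) (D' y) < e" and "y \<in> ball x r"
      then have "norm (D n y - D' y) \<le> e" using r(2) by (force simp: dist_norm)
      then have "norm (D n y - D' y) * norm h \<le> e * norm h"
        by (rule mult_right_mono) simp
      then show "norm (blinfun_apply (D n y) h - blinfun_apply (D' y) h) \<le> e * norm h"
        using norm_blinfun[of "D n y - D' y" h] by (simp add: blinfun.diff_left)
    qed
    show "x \<in> ball x r" "(\<lambda>n. f n x) \<longlonglongrightarrow> g x" using r f \<open>x \<in> S\<close> by auto
  qed simp
  then obtain G where G: "\<And>y. y \<in> ball x r \<Longrightarrow> (\<lambda>n. f n y) \<longlonglongrightarrow> G y"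
      "(G has_derivative blinfun_apply (D' x)) (at x within ball x r)"
    using r(1) by (metis centre_in_ball)
  \<comment> \<open>The interchange theorem yields a limit \<open>G\<close> of its own. It must
    agree with \<open>g\<close> on the whole ball, not just at \<open>x\<close>, for the derivative
    to carry over.\<close>
  have "G y = g y" if "y \<in> ball x r" for y
    using G(1)[OF that] f[of y] that r(2) LIMSEQ_unique by blast
  moreover have "(G has_derivative blinfun_apply (D' x)) (at x)"
    using G(2) r(1) at_within_open[of x "ball x r"] by simp
  ultimately show ?thesis
    using r(1) by (metis centre_in_ball has_derivative_transform_within_open open_ball)
qed

text \<open>A Cauchy sequence has uniformly Cauchy differentials of every order up to
  \<open>k\<close>. Induction on the order identifies their limits with the differentials of the
  pointwise limit \<open>f\<close>, and uniformity gives continuity, boundedness and convergence in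
  \<open>BC_dist\<close>.\<close>

lemma mcomplete_BC:
  fixes \<Omega> :: "'z::real_normed_vector set"
  assumes "open \<Omega>" "\<Omega> \<noteq> {}"
  shows "Metric_space.mcomplete (BC k \<Omega> :: ('z \<Rightarrow> 'y::banach) set) (BC_dist k \<Omega>)"
proof -
  interpret Metric_space "BC k \<Omega> :: ('z \<Rightarrow> 'y) set" "BC_dist k \<Omega>"
    by (rule Metric_space_BC[OF assms])
  show ?thesis
    unfolding mcomplete_def
  proof (intro allI impI)
    fix F :: "nat \<Rightarrow> 'z \<Rightarrow> 'y"
    assume F: "MCauchy F"
    then have BC: "F n \<in> BC k \<Omega>" for n by (auto simp: MCauchy_def)
    then have Ck: "Ck k \<Omega> (F n)" for n by (simp add: BC_def)
    have ucauchy: "uniformly_Cauchy_on \<Omega> (\<lambda>n. ndiff p (F n))" if "p \<le> k" for p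
    proof (rule uniformly_Cauchy_onI)
      fix e :: real
      assume "0 < e"
      then obtain N where N: "\<And>m n. N \<le> m \<Longrightarrow> N \<le> n \<Longrightarrow> BC_dist k \<Omega> (F m) (F n) < e"
        using F unfolding MCauchy_def by blast
      have "dist (ndiff p (F m) x) (ndiff p (F n) x) < e" if "x \<in> \<Omega>" "N \<le> m" "N \<le> n" for x m n
        using BC_dist_le_iff[OF assms BC BC, THEN iffD1, OF order_refl] N[OF that(2,3)] that(1) \<open>p \<le> k\<close>
        by (meson order_le_less_trans)
      then show "\<exists>N. \<forall>x\<in>\<Omega>. \<forall>m\<ge>N. \<forall>n\<ge>N. dist (ndiff p (F m) x) (ndiff p (F n) x) < e"
        by blast
    qed
    \<comment> \<open>Members of \<open>BC k \<Omega>\<close> vanish off \<open>\<Omega>\<close>, so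
      the limit is set to 0 there.\<close>
    define f where "f x = (if x \<in> \<Omega> then lim (\<lambda>n. F n x) else 0)" for x
    have F_lim: "(\<lambda>n. F n x) \<longlonglongrightarrow> f x" if "x \<in> \<Omega>" for x
    proof -
      have "Cauchy (\<lambda>n. F n x)"
        using uniformly_Cauchy_imp_Cauchy[OF ucauchy[of 0] that]
        by (simp add: Cauchy_def dist_mlin_const)
      then show ?thesis
        using that by (simp add: f_def Cauchy_convergent_iff convergent_LIMSEQ_iff)
    qed
    \<comment> \<open>Completeness supplies some uniform limit, and it has to coincide with any
      known pointwise limit \<open>L\<close>.\<close>
    have unif_of_lim: "uniform_limit \<Omega> (\<lambda>n. ndiff p (F n)) L sequentially"
      if p: "p \<le> k" and L: "\<And>x. x \<in> \<Omega> \<Longrightarrow> (\<lambda>n. ndiff p (F n) x) \<longlonglongrightarrow> L x" for p L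
    proof -
      obtain L' where L': "uniform_limit \<Omega> (\<lambda>n. ndiff p (F n)) L' sequentially"
        using Cauchy_uniformly_convergent[OF ucauchy[OF p]] by (auto simp: uniformly_convergent_on_def)
      have "L' x = L x" if "x \<in> \<Omega>" for x
        using tendsto_uniform_limitI[OF L' that] L[OF that] LIMSEQ_unique by blast
      then show ?thesis using L' by (simp cong: uniform_limit_cong')
    qed
    \<comment> \<open>The inductive step: pointwise convergence in order \<open>p\<close> suffices,
      since the derivatives converge uniformly to \<open>D\<close>. The uncurrying isometry then
      moves the limit to order \<open>Suc p\<close>.\<close>
    have step: "(ndiff p f has_derivative blinfun_apply (D x)) (at x)"
        "(\<lambda>n. ndiff (Suc p) (F n) x) \<longlonglongrightarrow> ndiff (Suc p) f x"
      if D: "uniform_limit \<Omega> (\<lambda>n x. Blinfun (frechet_derivative (ndiff p (F n)) (at x))) D sequentially"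
        and "p < k" "x \<in> \<Omega>" and lim: "\<And>x. x \<in> \<Omega> \<Longrightarrow> (\<lambda>n. ndiff p (F n) x) \<longlonglongrightarrow> ndiff p f x"
      for p D x
    proof -
      show der: "(ndiff p f has_derivative blinfun_apply (D x)) (at x)"
      proof (rule has_derivative_uniform_limit[OF assms(1) _ lim D \<open>x \<in> \<Omega>\<close>])
        fix n x
        assume "x \<in> \<Omega>"
        then have "ndiff p (F n) differentiable (at x)" using Ck \<open>p < k\<close> by (simp add: Ck_def)
        then have "(ndiff p (F n) has_derivative frechet_derivative (ndiff p (F n)) (at x)) (at x)"
          by (simp only: frechet_derivative_works)
        then show "(ndiff p (F n) has_derivative
            blinfun_apply (Blinfun (frechet_derivative (ndiff p (F n)) (at x)))) (at x)"
          by (metis bounded_linear_Blinfun_apply has_derivative_bounded_linear)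
      qed
      show "(\<lambda>n. ndiff (Suc p) (F n) x) \<longlonglongrightarrow> ndiff (Suc p) f x"
        using tendsto_uniform_limitI[OF D \<open>x \<in> \<Omega>\<close>]
        unfolding ndiff_Suc_has_derivative[OF der]
        by (simp add: tendsto_iff dist_mlin_uncurry)
    qed
    have derivs: "\<exists>D. uniform_limit \<Omega> (\<lambda>n x. Blinfun (frechet_derivative (ndiff p (F n)) (at x))) D sequentially"
      if "p < k" for p
    proof -
      have "uniformly_Cauchy_on \<Omega> (\<lambda>n x. Blinfun (frechet_derivative (ndiff p (F n)) (at x)))"
        using ucauchy[of "Suc p"] that by (simp add: uniformly_Cauchy_on_def dist_mlin_uncurry)
      then show ?thesis using Cauchy_uniformly_convergent by (auto simp: uniformly_convergent_on_def)
    qed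
    have lim: "(\<lambda>n. ndiff p (F n) x) \<longlonglongrightarrow> ndiff p f x" if "p \<le> k" "x \<in> \<Omega>" for p x
      using that
    proof (induction p arbitrary: x)
      case 0
      then show ?case using F_lim[OF 0(2)] by (simp add: tendsto_iff dist_mlin_const)
    next
      case (Suc p)
      obtain D where "uniform_limit \<Omega> (\<lambda>n x. Blinfun (frechet_derivative (ndiff p (F n)) (at x))) D sequentially"
        using derivs[of p] Suc.prems by auto
      from step(2)[OF this] show ?case using Suc by auto
    qed
    have unif: "uniform_limit \<Omega> (\<lambda>n. ndiff p (F n)) (ndiff p f) sequentially" if "p \<le> k" for p
      using unif_of_lim lim that by blast
    have "f \<in> BC k \<Omega>"
      unfolding BC_def Ck_def mem_Collect_eq
    proof (intro conjI allI impI ballI)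
      fix p x
      assume p: "p < k" and x: "x \<in> \<Omega>"
      obtain D where "uniform_limit \<Omega> (\<lambda>n x. Blinfun (frechet_derivative (ndiff p (F n)) (at x))) D sequentially"
        using derivs[OF p] by auto
      from step(1)[OF this p x] lim p show "ndiff p f differentiable (at x)"
        by (auto intro: differentiableI)
    next
      fix p
      assume p: "p \<le> k"
      show "continuous_on \<Omega> (ndiff p f)"
        using Ck p by (intro uniform_limit_theorem[OF _ unif[OF p]]) (auto simp: Ck_def)
      show "bounded (ndiff p f ` \<Omega>)"
        using BC p by (intro uniform_limit_bounded[OF unif[OF p]]) (auto simp: BC_def)
    qed (simp add: f_def)
    moreover have "\<exists>N. \<forall>n\<ge>N. BC_dist k \<Omega> (F n) f < e" if "0 < e" for e
    proof -
      \<comment> \<open>Only finitely many orders occur, so one tail of the sequence serves them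
        all.\<close>
      have "\<forall>\<^sub>F n in sequentially. \<forall>p\<in>{..k}. \<forall>x\<in>\<Omega>. dist (ndiff p (F n) x) (ndiff p f x) < e / 2"
        using unif that by (intro eventually_ball_finite ballI uniform_limitD) auto
      then have "\<forall>\<^sub>F n in sequentially. BC_dist k \<Omega> (F n) f < e"
      proof (rule eventually_mono)
        fix n
        assume *: "\<forall>p\<in>{..k}. \<forall>x\<in>\<Omega>. dist (ndiff p (F n) x) (ndiff p f x) < e / 2"
        have "BC_dist k \<Omega> (F n) f \<le> e / 2"
          unfolding BC_dist_le_iff[OF assms BC \<open>f \<in> BC k \<Omega>\<close>] using * by (auto intro: less_imp_le)
        then show "BC_dist k \<Omega> (F n) f < e" using that by simp
      qed
      then show ?thesis by (simp add: eventually_sequentially)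
    qed
    ultimately show "\<exists>f. limitin mtopology F f sequentially"
      using BC by (auto simp: limit_metric_sequentially)
  qed
qed

section \<open>Measures of noncompactness\<close>

text \<open>If the infimum is 0, some admissible number lies below any given \<open>e\<close>, and
  monotonicity raises it to \<open>e\<close>. This frees both \<open>kuratowski\<close> and
  \<open>omega_BC\<close> from infima.\<close>

lemma INF_ennreal_eq_0_iff:
  fixes Q :: "real \<Rightarrow> bool"
  assumes mono: "\<And>a b. Q a \<Longrightarrow> a \<le> b \<Longrightarrow> Q b"
  shows "(INF \<epsilon>\<in>{\<epsilon>. 0 < \<epsilon> \<and> Q \<epsilon>}. ennreal \<epsilon>) = 0 \<longleftrightarrow> (\<forall>e>0. Q e)"
    (is "?I = 0 \<longleftrightarrow> _")
proof
  assume 0: "?I = 0"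
  show "\<forall>e>0. Q e"
  proof (intro allI impI)
    fix e :: real
    assume "0 < e"
    then have "?I < ennreal e" using 0 by simp
    then show "Q e"
      unfolding INF_less_iff by (auto simp: ennreal_less_iff intro: mono less_imp_le)
  qed
next
  assume *: "\<forall>e>0. Q e"
  have "?I \<le> 0"
  proof (rule ennreal_le_epsilon)
    fix e :: real
    assume "0 < e"
    then show "?I \<le> 0 + ennreal e"
      using * by (auto intro!: INF_lower2[of e])
  qed
  then show "?I = 0" by simp
qed

lemma kuratowski_eq_0_iff:
  "kuratowski A = 0 \<longleftrightarrow>
    (\<forall>e>0. \<exists>\<B>. finite \<B> \<and> A \<subseteq> \<Union>\<B> \<and> (\<forall>B\<in>\<B>. bounded B \<and> diameter B \<le> e))"
  unfolding kuratowski_def by (rule INF_ennreal_eq_0_iff) (meson order_trans)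

lemma pointwise_relatively_compact_iff:
  assumes "\<Omega> \<noteq> {}"
  shows "pointwise_relatively_compact k \<Omega> M \<longleftrightarrow>
    (\<forall>p\<le>k. \<forall>x\<in>\<Omega>. kuratowski ((\<lambda>f. ndiff p f x) ` M) = 0)"
proof -
  \<comment> \<open>Upper bounds, unlike equations, can be checked term by term under
    \<open>Max\<close> and \<open>SUP\<close>.\<close>
  have "mu_alpha k \<Omega> M = 0 \<longleftrightarrow> mu_alpha k \<Omega> M \<le> 0" by simp
  also have "\<dots> \<longleftrightarrow> (\<forall>p\<le>k. \<forall>x\<in>\<Omega>. kuratowski ((\<lambda>f. ndiff p f x) ` M) \<le> 0)"
    unfolding mu_alpha_def by (subst Max_le_iff) (auto simp: SUP_le_iff simp del: le_zero_eq)
  finally show ?thesis by (simp add: pointwise_relatively_compact_def)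
qed

lemma extendedly_equicontinuous_iff:
  "extendedly_equicontinuous k \<Omega> M \<longleftrightarrow>
    (\<forall>e>0. \<exists>P \<Phi>. finite P \<and> partition_on \<Omega> P \<and> finite \<Phi> \<and> \<Phi> \<subseteq> BC k \<Omega> \<and>
      (\<forall>f\<in>M. \<exists>\<phi>\<in>\<Phi>. \<forall>A\<in>P. \<forall>p\<le>k. diameter (ndiff p (\<lambda>x. f x - \<phi> x) ` A) \<le> e))"
proof -
  have "(MAX p\<in>{..k}. diameter (ndiff p g ` A)) \<le> e \<longleftrightarrow> (\<forall>p\<le>k. diameter (ndiff p g ` A) \<le> e)"
    for e and g :: "'a \<Rightarrow> 'b" and A
    by (subst Max_le_iff) auto
  then show ?thesis
    unfolding extendedly_equicontinuous_def omega_BC_def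
    by (simp only:) (rule INF_ennreal_eq_0_iff, meson order_trans)
qed

text \<open>One representative from each of the finitely many fibres of \<open>s\<close> gives a
  finite net. In this form total boundedness follows from sorting functions by finitely many
  data.\<close>

lemma (in Metric_space) mtotally_boundedI_classes:
  assumes "S \<subseteq> M"
    and cl: "\<And>e. 0 < e \<Longrightarrow> \<exists>s :: 'a \<Rightarrow> 's. finite (s ` S) \<and> (\<forall>x\<in>S. \<forall>y\<in>S. s x = s y \<longrightarrow> d x y < e)"
  shows "mtotally_bounded S"
  unfolding mtotally_bounded_def
proof (intro allI impI)
  fix e :: real
  assume "0 < e"
  then obtain s :: "'a \<Rightarrow> 's" where s: "finite (s ` S)" "\<And>x y. x \<in> S \<Longrightarrow> y \<in> S \<Longrightarrow> s x = s y \<Longrightarrow> d x y < e"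
    using cl by blast
  \<comment> \<open>\<open>inv_into\<close> picks the representatives inside \<open>S\<close>, where
    \<open>mtotally_bounded\<close> wants the centres.\<close>
  let ?K = "inv_into S s ` s ` S"
  have "x \<in> (\<Union>y\<in>?K. mball y e)" if "x \<in> S" for x
  proof -
    have "inv_into S s (s x) \<in> S" "s (inv_into S s (s x)) = s x"
      using that by (auto intro: inv_into_into f_inv_into_f)
    then have "x \<in> mball (inv_into S s (s x)) e" using s(2) that assms(1) by auto
    then show ?thesis using that by blast
  qed
  moreover have "?K \<subseteq> S" by (auto intro: inv_into_into)
  ultimately show "\<exists>K. finite K \<and> K \<subseteq> S \<and> S \<subseteq> (\<Union>x\<in>K. mball x e)"
    using s(1) by blast
qed

section \<open>The compactness criterion\<close>

theorem corollary4p1: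
  fixes \<Omega> :: "'z::banach set"
    and M :: "('z \<Rightarrow> 'y::banach) set"
    and k :: nat
  assumes "open \<Omega>" and "\<Omega> \<noteq> {}"
    and "M \<subseteq> BC k \<Omega>"
  shows "BC_relatively_compact k \<Omega> M \<longleftrightarrow>
    BC_bounded k \<Omega> M \<and> extendedly_equicontinuous k \<Omega> M \<and> pointwise_relatively_compact k \<Omega> M"
proof -
  interpret BC: Metric_space "BC k \<Omega> :: ('z \<Rightarrow> 'y) set" "BC_dist k \<Omega>"
    by (rule Metric_space_BC[OF assms(1,2)])
  have compact_iff: "BC_relatively_compact k \<Omega> M \<longleftrightarrow> BC.mtotally_bounded M"
    using BC.mtotally_bounded_eq_compact_closure_of[OF mcomplete_BC[OF assms(1,2)]] assms(3)
    by (simp add: BC_relatively_compact_def)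
  have ndiff_diff': "ndiff p (\<lambda>x. f x - g x) x = ndiff p f x - ndiff p g x"
    if "f \<in> BC k \<Omega>" "g \<in> BC k \<Omega>" "p \<le> k" "x \<in> \<Omega>" for f g :: "'z \<Rightarrow> 'y" and p x
    using ndiff_diff(1)[OF assms(1)] that by (auto simp: BC_def)
  show ?thesis
    unfolding compact_iff
  proof (intro iffI conjI)

    \<comment> \<open>Necessity of the three conditions\<close>
    assume M: "BC.mtotally_bounded M"
    show "BC_bounded k \<Omega> M"
      unfolding BC_bounded_def by (rule BC.mtotally_bounded_imp_mbounded[OF M])
    \<comment> \<open>A finite net in \<open>BC_dist\<close> is restated as an estimate uniform in
      \<open>p\<close> and \<open>x\<close>; both remaining conditions are read off from it.\<close>
    have net: "\<exists>K. finite K \<and> K \<subseteq> M \<and>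
        (\<forall>f\<in>M. \<exists>g\<in>K. \<forall>p\<le>k. \<forall>x\<in>\<Omega>. dist (ndiff p f x) (ndiff p g x) \<le> e)" if e: "0 < e" for e
    proof -
      obtain K where K: "finite K" "K \<subseteq> M" "M \<subseteq> (\<Union>g\<in>K. BC.mball g e)"
        using M e unfolding BC.mtotally_bounded_def by meson
      have "\<exists>g\<in>K. \<forall>p\<le>k. \<forall>x\<in>\<Omega>. dist (ndiff p f x) (ndiff p g x) \<le> e" if f: "f \<in> M" for f
      proof -
        obtain g where g: "g \<in> K" "g \<in> BC k \<Omega>" "f \<in> BC k \<Omega>" "BC_dist k \<Omega> g f < e"
          using K(3) f by auto
        then have "BC_dist k \<Omega> f g \<le> e" by (simp add: BC.commute)
        then show ?thesis
          using g by (subst (asm) BC_dist_le_iff[OF assms(1,2)]) auto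
      qed
      then show ?thesis using K by blast
    qed
    show "extendedly_equicontinuous k \<Omega> M"
      unfolding extendedly_equicontinuous_iff
    proof (intro allI impI)
      fix e :: real
      assume "0 < e"
      \<comment> \<open>Radius \<open>e / 2\<close>, because two operators of norm at most
        \<open>e / 2\<close> are within \<open>e\<close> of each other.\<close>
      then obtain K where K: "finite K" "K \<subseteq> M"
          "\<And>f. f \<in> M \<Longrightarrow> \<exists>g\<in>K. \<forall>p\<le>k. \<forall>x\<in>\<Omega>. dist (ndiff p f x) (ndiff p g x) \<le> e / 2"
        using net[of "e / 2"] by auto
      have "\<exists>g\<in>K. \<forall>A\<in>{\<Omega>}. \<forall>p\<le>k. diameter (ndiff p (\<lambda>x. f x - g x) ` A) \<le> e" if f: "f \<in> M" for f
      proof -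
        obtain g where g: "g \<in> K" "\<And>p x. p \<le> k \<Longrightarrow> x \<in> \<Omega> \<Longrightarrow> dist (ndiff p f x) (ndiff p g x) \<le> e / 2"
          using K(3)[OF f] by blast
        have BC: "f \<in> BC k \<Omega>" "g \<in> BC k \<Omega>" using f g(1) assms(3) K(2) by auto
        have n: "norm (ndiff p (\<lambda>x. f x - g x) x) \<le> e / 2" if "p \<le> k" "x \<in> \<Omega>" for p x
          using g(2)[OF that] ndiff_diff'[OF BC that] by (simp add: dist_norm)
        have "diameter (ndiff p (\<lambda>x. f x - g x) ` \<Omega>) \<le> e" if "p \<le> k" for p
        proof (rule diameter_le)
          fix a b
          assume "a \<in> ndiff p (\<lambda>x. f x - g x) ` \<Omega>" "b \<in> ndiff p (\<lambda>x. f x - g x) ` \<Omega>"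
          then have "norm a \<le> e / 2" "norm b \<le> e / 2" using n[OF that] by auto
          then show "norm (a - b) \<le> e" using norm_triangle_ineq4[of a b] by simp
        qed (use \<open>0 < e\<close> in simp)
        then show ?thesis using g(1) by auto
      qed
      then show "\<exists>P \<Phi>. finite P \<and> partition_on \<Omega> P \<and> finite \<Phi> \<and> \<Phi> \<subseteq> BC k \<Omega> \<and>
          (\<forall>f\<in>M. \<exists>\<phi>\<in>\<Phi>. \<forall>A\<in>P. \<forall>p\<le>k. diameter (ndiff p (\<lambda>x. f x - \<phi> x) ` A) \<le> e)"
        using K(1,2) assms(2,3)
        by (intro exI[of _ "{\<Omega>}"] exI[of _ K]) (auto simp: partition_on_def)
    qed
    show "pointwise_relatively_compact k \<Omega> M"
      unfolding pointwise_relatively_compact_iff[OF assms(2)] kuratowski_eq_0_iff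
    proof (intro allI impI ballI)
      fix p x and e :: real
      assume p: "p \<le> k" and x: "x \<in> \<Omega>" and "0 < e"
      then obtain K where K: "finite K" "K \<subseteq> M"
          "\<And>f. f \<in> M \<Longrightarrow> \<exists>g\<in>K. \<forall>p\<le>k. \<forall>x\<in>\<Omega>. dist (ndiff p f x) (ndiff p g x) \<le> e / 2"
        using net[of "e / 2"] by auto
      \<comment> \<open>Closed balls around the values of the net at \<open>x\<close>; radius
        \<open>e / 2\<close> keeps their diameters within \<open>e\<close>.\<close>
      let ?B = "(\<lambda>g. cball (ndiff p g x) (e / 2)) ` K"
      have "(\<lambda>f. ndiff p f x) ` M \<subseteq> \<Union>?B"
        using K(3) p x by (fastforce simp: dist_commute)
      moreover have "diameter (cball c (e / 2)) \<le> e" for c :: "('z, 'y) mlin"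
      proof (rule diameter_le)
        show "norm (a - b) \<le> e" if "a \<in> cball c (e / 2)" "b \<in> cball c (e / 2)" for a b
          using that dist_triangle3[of a b c] by (simp add: dist_norm norm_minus_commute)
      qed (use \<open>0 < e\<close> in simp)
      ultimately show "\<exists>\<B>. finite \<B> \<and> (\<lambda>f. ndiff p f x) ` M \<subseteq> \<Union>\<B> \<and>
          (\<forall>B\<in>\<B>. bounded B \<and> diameter B \<le> e)"
        using K(1) by (intro exI[of _ ?B]) auto
    qed
  next

    \<comment> \<open>Sufficiency: sorting \<open>M\<close> into finitely many small classes\<close>
    assume "BC_bounded k \<Omega> M \<and> extendedly_equicontinuous k \<Omega> M \<and> pointwise_relatively_compact k \<Omega> M"
    then have ext: "extendedly_equicontinuous k \<Omega> M" and pw: "pointwise_relatively_compact k \<Omega> M"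
      by auto
    show "BC.mtotally_bounded M"
    proof (rule BC.mtotally_boundedI_classes[OF assms(3)])
      fix e' :: real
      assume "0 < e'"
      \<comment> \<open>The final estimate has three terms of size \<open>e\<close>; a quarter of
        \<open>e'\<close> leaves it strictly below \<open>e'\<close>.\<close>
      define e where "e = e' / 4"
      have e: "0 < e" "3 * e < e'" using \<open>0 < e'\<close> by (auto simp: e_def)
      obtain P \<Phi> where P: "finite P" "partition_on \<Omega> P" and \<Phi>: "finite \<Phi>" "\<Phi> \<subseteq> BC k \<Omega>"
        and "\<forall>f\<in>M. \<exists>\<phi>\<in>\<Phi>. \<forall>A\<in>P. \<forall>p\<le>k. diameter (ndiff p (\<lambda>x. f x - \<phi> x) ` A) \<le> e"
        using ext e(1) unfolding extendedly_equicontinuous_iff by meson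
      then obtain \<phi> where \<phi>: "\<And>f. f \<in> M \<Longrightarrow> \<phi> f \<in> \<Phi>"
          "\<And>f A p. f \<in> M \<Longrightarrow> A \<in> P \<Longrightarrow> p \<le> k \<Longrightarrow> diameter (ndiff p (\<lambda>x. f x - \<phi> f x) ` A) \<le> e"
        by metis
      \<comment> \<open>The cells of a partition are nonempty, so each has a sample point
        \<open>c A\<close>.\<close>
      have "\<exists>x. x \<in> A" if "A \<in> P" for A using P(2) that unfolding partition_on_def by (metis ex_in_conv)
      then obtain c where c: "\<And>A. A \<in> P \<Longrightarrow> c A \<in> A" by metis
      have sub: "A \<subseteq> \<Omega>" if "A \<in> P" for A using P(2) that by (auto simp: partition_on_def)
      have "\<exists>\<B>. finite \<B> \<and> (\<lambda>f. ndiff p f (c A)) ` M \<subseteq> \<Union>\<B> \<and> (\<forall>B\<in>\<B>. bounded B \<and> diameter B \<le> e)"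
        if "A \<in> P" "p \<le> k" for A p
      proof -
        have "c A \<in> \<Omega>" using c sub that(1) by blast
        then show ?thesis
          using pw e(1) that(2) unfolding pointwise_relatively_compact_iff[OF assms(2)] kuratowski_eq_0_iff
          by simp
      qed
      then obtain \<B> where \<B>: "\<And>A p. A \<in> P \<Longrightarrow> p \<le> k \<Longrightarrow> finite (\<B> A p) \<and>
          (\<lambda>f. ndiff p f (c A)) ` M \<subseteq> \<Union>(\<B> A p) \<and> (\<forall>B\<in>\<B> A p. bounded B \<and> diameter B \<le> e)"
        by metis
      define b where "b f A p = (SOME B. B \<in> \<B> A p \<and> ndiff p f (c A) \<in> B)" for f A p
      have b: "b f A p \<in> \<B> A p \<and> ndiff p f (c A) \<in> b f A p"
        if "A \<in> P" "p \<le> k" "f \<in> M" for A p f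
        unfolding b_def by (rule someI_ex) (use \<B>[OF that(1,2)] that(3) in blast)
      \<comment> \<open>The class of \<open>f\<close> records its \<open>\<phi> f\<close> and, for
        every cell and order, the covering set that contains its differential at the sample point.
        The restricted lambda is \<open>undefined\<close> off \<open>P \<times> {..k}\<close>, which
        puts it in a finite extensional product.\<close>
      define s where "s f = (\<phi> f, \<lambda>i\<in>P \<times> {..k}. b f (fst i) (snd i))" for f
      have "s f \<in> \<Phi> \<times> (\<Pi>\<^sub>E i\<in>P \<times> {..k}. \<B> (fst i) (snd i))" if "f \<in> M" for f
        unfolding s_def
        by (intro SigmaI restrict_PiE_iff[THEN iffD2] ballI) (use \<phi>(1) b that in auto)
      then have "s ` M \<subseteq> \<Phi> \<times> (\<Pi>\<^sub>E i\<in>P \<times> {..k}. \<B> (fst i) (snd i))"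
        by blast
      moreover have "finite (\<Pi>\<^sub>E i\<in>P \<times> {..k}. \<B> (fst i) (snd i))"
        using P(1) \<B> by (intro finite_PiE) auto
      ultimately have "finite (s ` M)"
        using \<Phi>(1) by (meson finite_SigmaI finite_subset)
      moreover have "BC_dist k \<Omega> f g < e'" if f: "f \<in> M" and g: "g \<in> M" and s: "s f = s g" for f g
      proof -
        have eq: "\<phi> f = \<phi> g" using s by (simp add: s_def)
        have BC: "f \<in> BC k \<Omega>" "g \<in> BC k \<Omega>" using f g assms(3) by auto
        \<comment> \<open>The diameter controls distances only on a bounded set; boundedness comes
          from \<open>h - \<phi> h\<close> lying in \<open>BC k \<Omega>\<close>.\<close>
        have osc: "dist (ndiff p h x - ndiff p (\<phi> h) x) (ndiff p h y - ndiff p (\<phi> h) y) \<le> e"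
          if "h \<in> M" "A \<in> P" "p \<le> k" "x \<in> A" "y \<in> A" for h A p x y
        proof -
          have h: "h \<in> BC k \<Omega>" "\<phi> h \<in> BC k \<Omega>" using \<open>h \<in> M\<close> assms(3) \<Phi>(2) \<phi>(1) by auto
          have "bounded (ndiff p (\<lambda>x. h x - \<phi> h x) ` \<Omega>)"
            using BC_diff[OF assms(1) h] \<open>p \<le> k\<close> by (simp add: BC_def)
          then have "bounded (ndiff p (\<lambda>x. h x - \<phi> h x) ` A)"
            by (rule bounded_subset) (use sub[OF \<open>A \<in> P\<close>] in blast)
          then have "dist (ndiff p (\<lambda>x. h x - \<phi> h x) x) (ndiff p (\<lambda>x. h x - \<phi> h x) y) \<le> e"
            using diameter_bounded_bound \<phi>(2) that by (meson imageI order_trans)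
          then show ?thesis
            using ndiff_diff'[OF h] that sub by (simp add: subset_iff)
        qed
        have "dist (ndiff p f x) (ndiff p g x) \<le> 3 * e" if p: "p \<le> k" and x: "x \<in> \<Omega>" for p x
        proof -
          obtain A where A: "A \<in> P" "x \<in> A" using P(2) x by (auto simp: partition_on_def)
          \<comment> \<open>Equality of the second components of \<open>s f\<close> and
            \<open>s g\<close>, evaluated at \<open>(A, p)\<close>.\<close>
          have "b f A p = b g A p"
            using fun_cong[OF arg_cong[OF s, of snd], of "(A, p)"] A(1) p by (simp add: s_def)
          moreover have "bounded (b f A p)" "diameter (b f A p) \<le> e"
            using \<B>[OF A(1) p] b[OF A(1) p f] by auto
          ultimately have "dist (ndiff p f (c A)) (ndiff p g (c A)) \<le> e"
            using b[OF A(1) p f] b[OF A(1) p g] by (metis diameter_bounded_bound order_trans)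
          moreover note osc[OF f A(1) p A(2) c[OF A(1)]] osc[OF g A(1) p A(2) c[OF A(1)]]
          \<comment> \<open>The difference at \<open>x\<close> is the oscillation of
            \<open>f - \<phi> f\<close> between \<open>x\<close> and \<open>c A\<close>, minus that
            of \<open>g - \<phi> g\<close>, plus the difference at \<open>c A\<close>. The terms in
            \<open>\<phi>\<close> cancel because \<open>\<phi> f = \<phi> g\<close>.\<close>
          ultimately show ?thesis
            unfolding eq dist_norm
            using norm_triangle_ineq4[of "(ndiff p f x - ndiff p (\<phi> g) x) - (ndiff p f (c A) - ndiff p (\<phi> g) (c A))"
                "(ndiff p g x - ndiff p (\<phi> g) x) - (ndiff p g (c A) - ndiff p (\<phi> g) (c A))"]
              norm_triangle_ineq[of "((ndiff p f x - ndiff p (\<phi> g) x) - (ndiff p f (c A) - ndiff p (\<phi> g) (c A)))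
                - ((ndiff p g x - ndiff p (\<phi> g) x) - (ndiff p g (c A) - ndiff p (\<phi> g) (c A)))"
                "ndiff p f (c A) - ndiff p g (c A)"]
            by (simp add: algebra_simps)
        qed
        then have "BC_dist k \<Omega> f g \<le> 3 * e"
          by (subst BC_dist_le_iff[OF assms(1,2) BC]) blast
        then show ?thesis using e(2) by linarith
      qed
      ultimately show "\<exists>s :: ('z \<Rightarrow> 'y) \<Rightarrow> ('z \<Rightarrow> 'y) \<times> ('z set \<times> nat \<Rightarrow> ('z, 'y) mlin set).
          finite (s ` M) \<and> (\<forall>f\<in>M. \<forall>g\<in>M. s f = s g \<longrightarrow> BC_dist k \<Omega> f g < e')"
        by blast
    qed
  qed
qed

end
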